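(* The Lagrangians $$L^{ij}=\frac{1}{2s^{ij}c^{ij}c^{ji}}\big(u_{ij}-c^{ji}u_i-c^{ij}u_j-c^{ij}c^{ji}u\big)^2,\qquad s^{ij}=-s^{ji},$$ assigned to the oriented plaquettes of $\mathbb Z^N$ ($N\ge 3$) are consistent if and only if the coefficients are governed by the following (4D-consistent) mapping: $$c^{ij}_k=\frac{1}{c^{kj}}\big(c^{ik}c^{ki}-c^{ik}c^{kj}-c^{ki}c^{ij}\big),$$ $$s^{ij}_k=c^{ki}c^{kj}s^{ij}+c^{ki}(c^{ij}-c^{ik})s^{jk}+c^{kj}(c^{ji}-c^{jk})s^{ki},$$ for every elementary cube and all permutations $(i,j,k)$ of its three directions.
   Context: Notation on the lattice: $n\in\mathbb Z^N$, $e_i$ is the $i$-th coordinate vector, $T_i:n\mapsto n+e_i$. Subscripts denote shifts: $u=u(n)$, $u_i=u(n+e_i)$, $u_{ij}=u(n+e_i+e_j)$, etc. The coefficients $s^{ij}$, $c^{ij}$, $c^{ji}$ are attached to the plaquette $\sigma^{ij}(n)=(n,n+e_i,n+e_i+e_j,n+e_j)$ and depend on the plaquette ($c^{ij}$ and $c^{ji}$ are independent of each other); all of them are nonzero; $c^{ij}_k=T_kc^{ij}$, $s^{ij}_k=T_ks^{ij}$ are attached to $\sigma^{ij}(n+e_k)$. Consistency. For an elementary cube with base point $n$ and distinct directions $i,j,k$, put $$S^{ijk}=(T_k-I)L^{ij}+(T_i-I)L^{jk}+(T_j-I)L^{ki},$$ a function of the eight fields $u,u_i,u_j,u_k,u_{ij},u_{jk},u_{ik},u_{ijk}$.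 The corner equations are the eight (here linear) equations $\partial S^{ijk}/\partial w=0$, $w$ running over these eight fields. The system of corner equations is called consistent if for every elementary cube it has the minimal possible rank $2$, i.e. exactly two of the eight equations are linearly independent. This is the local form of the following consistency of the pluri-Lagrangian problem: for any quad-surface $\Sigma$ flippable to the whole of $\mathbb Z^N$ (by successive flips of $\Sigma$ across elementary 3D cubes one can reach the whole lattice), any generic solution on $\Sigma$ of the discrete Euler-Lagrange equations $\partial S_\Sigma/\partial u(n)=0$ ($n$ interior vertex of $\Sigma$, $S_\Sigma=\sum_{\sigma^{ij}\in\Sigma}L^{ij}$) can be extended to a solution of the system of corner equations on the whole $\mathbb Z^N$. 4D-consistency of the mapping: for distinct directions $i,j,k,l$, starting with generic coefficients on the six plaquettes adjacent to the base vertex of a 4D cube, the two ways of computing the doubly shifted coefficients agree: $T_l(c^{ij}_k)=T_k(c^{ij}_l)$ and $T_l(s^{ij}_k)=T_k(s^{ij}_l)$. *)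

theory Defs
  imports "HOL-Analysis.Analysis" "HOL-Library.Function_Algebras"
begin

text \<open>The lattice is \<open>int ^ 'd\<close>, with \<open>CARD('d)\<close> the dimension. Coefficients are families
  \<open>c n i j\<close>, \<open>s n i j\<close>: the values of \<open>c\<^sup>i\<^sup>j\<close>, \<open>s\<^sup>i\<^sup>j\<close> on the plaquette with base point \<open>n\<close> and
  directions \<open>i \<noteq> j\<close>. The values on the diagonal \<open>i = j\<close> carry no meaning and are never used.\<close>

type_synonym 'd lattice = "int ^ 'd"
type_synonym 'd coeffs = "'d \<Rightarrow> 'd \<Rightarrow> real"
type_synonym 'd field_config = "'d lattice \<Rightarrow> real"

abbreviation ev :: "'d::finite \<Rightarrow> 'd lattice" where
  "ev i \<equiv> axis i 1"

definition lagrangian ::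
  "('d::finite lattice \<Rightarrow> 'd coeffs) \<Rightarrow> ('d lattice \<Rightarrow> 'd coeffs) \<Rightarrow> 'd \<Rightarrow> 'd \<Rightarrow> 'd lattice
    \<Rightarrow> 'd field_config \<Rightarrow> real" where
  "lagrangian c s i j n u =
     1 / (2 * s n i j * c n i j * c n j i)
       * (u (n + ev i + ev j) - c n j i * u (n + ev i) - c n i j * u (n + ev j)
            - c n i j * c n j i * u n)\<^sup>2"

definition cube_action ::
  "('d::finite lattice \<Rightarrow> 'd coeffs) \<Rightarrow> ('d lattice \<Rightarrow> 'd coeffs) \<Rightarrow> 'd \<Rightarrow> 'd \<Rightarrow> 'd \<Rightarrow> 'd lattice
    \<Rightarrow> 'd field_config \<Rightarrow> real" where
  "cube_action c s i j k n u =
     (lagrangian c s i j (n + ev k) u - lagrangian c s i j n u)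
   + (lagrangian c s j k (n + ev i) u - lagrangian c s j k n u)
   + (lagrangian c s k i (n + ev j) u - lagrangian c s k i n u)"

definition cube_vertices :: "'d::finite \<Rightarrow> 'd \<Rightarrow> 'd \<Rightarrow> 'd lattice \<Rightarrow> 'd lattice set" where
  "cube_vertices i j k n =
     {n, n + ev i, n + ev j, n + ev k,
      n + ev i + ev j, n + ev j + ev k, n + ev i + ev k, n + ev i + ev j + ev k}"

text \<open>The left-hand side of the corner equation at the vertex \<open>w\<close>: the partial derivative of the
  action of the cube with respect to the field value at \<open>w\<close>, as a functional of the field.\<close>

definition corner_expr ::
  "('d::finite lattice \<Rightarrow> 'd coeffs) \<Rightarrow> ('d lattice \<Rightarrow> 'd coeffs) \<Rightarrow> 'd \<Rightarrow> 'd \<Rightarrow> 'd \<Rightarrow> 'd lattice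
    \<Rightarrow> 'd lattice \<Rightarrow> 'd field_config \<Rightarrow> real" where
  "corner_expr c s i j k n w u = deriv (\<lambda>t. cube_action c s i j k n (u(w := t))) (u w)"

interpretation functionals: vector_space "\<lambda>(r::real) (f::'a \<Rightarrow> real) x. r * f x"
  by unfold_locales (auto simp: fun_eq_iff algebra_simps)

text \<open>The rank of the system of corner equations is the dimension, in the real vector space of
  functionals, of the span of the eight left-hand sides.\<close>

definition corner_rank ::
  "('d::finite lattice \<Rightarrow> 'd coeffs) \<Rightarrow> ('d lattice \<Rightarrow> 'd coeffs) \<Rightarrow> 'd \<Rightarrow> 'd \<Rightarrow> 'd \<Rightarrow> 'd lattice
    \<Rightarrow> nat" where
  "corner_rank c s i j k n = functionals.dim (corner_expr c s i j k n ` cube_vertices i j k n)"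

definition consistent ::
  "('d::finite lattice \<Rightarrow> 'd coeffs) \<Rightarrow> ('d lattice \<Rightarrow> 'd coeffs) \<Rightarrow> bool" where
  "consistent c s \<longleftrightarrow> (\<forall>n i j k. distinct [i, j, k] \<longrightarrow> corner_rank c s i j k n = 2)"

text \<open>The mapping sends coefficients \<open>c\<close>, \<open>s\<close> on the plaquettes at a vertex to the coefficients
  \<open>c_shift c k i j\<close>, \<open>s_shift c s k i j\<close> on the plaquettes of directions \<open>i, j\<close> shifted by
  \<open>ev k\<close>; it is meaningful for distinct \<open>i, j, k\<close> only.\<close>

definition c_shift :: "'d coeffs \<Rightarrow> 'd \<Rightarrow> 'd coeffs" where
  "c_shift c k i j = 1 / c k j * (c i k * c k i - c i k * c k j - c k i * c i j)"

definition s_shift :: "'d coeffs \<Rightarrow> 'd coeffs \<Rightarrow> 'd \<Rightarrow> 'd coeffs" where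
  "s_shift c s k i j =
     c k i * c k j * s i j + c k i * (c i j - c i k) * s j k + c k j * (c j i - c j k) * s k i"

definition governed_by_mapping ::
  "('d::finite lattice \<Rightarrow> 'd coeffs) \<Rightarrow> ('d lattice \<Rightarrow> 'd coeffs) \<Rightarrow> bool" where
  "governed_by_mapping c s \<longleftrightarrow>
     (\<forall>n i j k. distinct [i, j, k] \<longrightarrow>
        c (n + ev k) i j = c_shift (c n) k i j \<and> s (n + ev k) i j = s_shift (c n) (s n) k i j)"

text \<open>4D-consistency concerns a single 4D cube, whose directions are labelled by the
  four-element type \<open>4\<close> so that the property does not depend on the lattice (and is not vacuous
  over a three-dimensional one). Generic initial data are those for which every denominator met
  in computing the doubly shifted coefficients is nonzero.\<close>

definition mapping_4D_consistent :: bool where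
  "mapping_4D_consistent \<longleftrightarrow>
     (\<forall>(c :: 4 coeffs) (s :: 4 coeffs).
        (\<forall>i j. i \<noteq> j \<longrightarrow> c i j \<noteq> 0 \<and> s i j = - s j i) \<longrightarrow>
        (\<forall>i j k. distinct [i, j, k] \<longrightarrow> c_shift c k i j \<noteq> 0) \<longrightarrow>
        (\<forall>i j k l. distinct [i, j, k, l] \<longrightarrow>
           c_shift (c_shift c l) k i j = c_shift (c_shift c k) l i j \<and>
           s_shift (c_shift c l) (s_shift c s l) k i j
             = s_shift (c_shift c k) (s_shift c s k) l i j))"

end

theory Submission
  imports Defs
begin

text \<open>
  The action of a cube is a quadratic form in the eight fields, and a corner equation is a row of
  its matrix. The rows at \<open>n\<close> and \<open>n + ev i\<close> are always independent, so rank two means that all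
  rows are combinations of these two.

  If this holds, comparing six columns of the relation expressing the row at \<open>n + ev j\<close> forces the
  mapping. For the converse, the six face forms \<open>u\<^sub>i\<^sub>j - c\<^sup>j\<^sup>iu\<^sub>i - c\<^sup>i\<^sup>ju\<^sub>j - c\<^sup>i\<^sup>jc\<^sup>j\<^sup>iu\<close> of the cube
  span only a four-dimensional space under the mapping: the form of each face through \<open>u\<^sub>i\<^sub>j\<^sub>k\<close>
  differs from one and the same form \<open>G\<close> by a combination of the forms of the three faces
  through \<open>u\<close>. In the basis of \<open>G\<close> and these three, expressing a row by the first two takes
  four scalar identities.

  For the 4D-consistency, both doubly shifted coefficients are brought to a form in which the
  symmetry in \<open>k\<close> and \<open>l\<close> is a polynomial identity.
\<close>

section \<open>Scalar identities for one cube\<close>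

text \<open>
  Here and below \<open>si\<close>, \<open>sj\<close>, \<open>sk\<close> stand for \<open>s\<^sup>j\<^sup>k\<close>, \<open>s\<^sup>k\<^sup>i\<close>, \<open>s\<^sup>i\<^sup>j\<close> at \<open>n\<close>, and \<open>ti\<close>, \<open>tj\<close>, \<open>tk\<close> for
  their shifts in the directions \<open>i\<close>, \<open>j\<close>, \<open>k\<close>; likewise \<open>ajk\<close> is \<open>c\<^sup>j\<^sup>k\<close> shifted by \<open>ev i\<close>, and so on.
  The hypotheses on \<open>x\<close>, \<open>y\<close> are the columns \<open>ijk\<close>, \<open>jk\<close>, \<open>ik\<close>, \<open>k\<close>, \<open>u\<close>, \<open>i\<close> of the relation
  \<open>row j = x * row u + y * row i\<close>.
\<close>

lemma mapping_from_row_relation: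
  fixes cij cji cjk ckj cki cik si sj sk ti tj ajk akj aik x y :: real
  assumes nz: "cij \<noteq> 0" "cji \<noteq> 0" "cjk \<noteq> 0" "ckj \<noteq> 0" "cki \<noteq> 0" "cik \<noteq> 0"
    "si \<noteq> 0" "sj \<noteq> 0" "sk \<noteq> 0" "ti \<noteq> 0" "tj \<noteq> 0" "ajk \<noteq> 0" "akj \<noteq> 0" "aik \<noteq> 0"
    and ijk: "- (1 / tj) = y * (- (1 / ti))"
    and jk: "1 / (si * cjk) + aik / tj = x / si"
    and ik: "0 = x / sj + y * (1 / (sj * cik) + ajk / ti)"
    and k: "- (1 / si) = x * (- cik / sj - cjk / si) - y / sj"
    and u: "- cij / sk - ckj / si = x * (- (cij * cji) / sk - cjk * ckj / si - cki * cik / sj)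
              + y * (- cji / sk - cki / sj)"
    and i: "- (1 / sk) = x * (- cji / sk - cki / sj)
              + y * (ajk * akj / ti - cji / (sk * cij) - cki / (sj * cik))"
  shows "cij * akj = cik * cki - cik * ckj - cki * cij"
    and "(cij * cji - cij * cjk - cji * cik) * ti =
       cik * ajk * (cik * (cij * si - cji * sj + (ckj - cki) * sk)
          - (cij * cji - cij * cjk - cji * cik) * sj)"
proof -
  \<comment> \<open>After multiplication by \<open>tj\<close> the relation reads
    \<open>tj * row j = ti * row i - \<mu> * row u\<close>.\<close>
  define \<mu> r where "\<mu> = - x * tj" and "r = cik * ajk"
  have x: "x = - \<mu> / tj" using nz by (simp add: \<mu>_def)
  have y: "y = ti / tj" using ijk nz by (simp add: field_simps)
  have tj: "tj = - cjk * (\<mu> + aik * si)" using jk nz unfolding x by (simp add: field_simps) algebra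
  have "sj * ti * tj * (ti - (cik * \<mu> - r * sj)) = 0"
    using ik nz unfolding x y r_def by (simp add: field_simps)
  then have ti: "ti = cik * \<mu> - r * sj" using nz by simp
  have "tj * sj - ti * si = - \<mu> * (cik * si + cjk * sj)"
    using k nz unfolding x y by (simp add: field_simps) algebra
  \<comment> \<open>In column \<open>k\<close> the multiplier \<mu> cancels, which leaves
    \<open>cjk * aik = cik * ajk\<close>.\<close>
  then have "si * sj * (cjk * aik - r) = 0" unfolding tj ti by algebra
  then have r: "cjk * aik = r" using nz by simp
  have tj': "tj = - cjk * \<mu> - r * si" using tj r by algebra
  have r0: "r \<noteq> 0" using nz by (simp add: r_def)
  define R where "R = cij * cji - cij * cjk - cji * cik"
  define M where "M = cij * si - cji * sj + (ckj - cki) * sk"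
  have "tj * (cij * si * sj + ckj * sj * sk) - ti * (cji * si * sj + cki * si * sk)
      = - \<mu> * (cij * cji * si * sj + cjk * ckj * sj * sk + cki * cik * si * sk)"
    using u nz unfolding x y by (simp add: field_simps) algebra
  \<comment> \<open>\<open>R\<close> is kept as a factor: it is seen to be nonzero only once the
    formula for the shifted \<open>c\<close> identifies it with \<open>r\<close>.\<close>
  then have "si * sj * (\<mu> * R - r * M) = 0" unfolding tj' ti R_def M_def by algebra
  then have mu: "\<mu> * R = r * M" using nz by simp
  have "ti * (- cji * cik * sj - cki * cij * sk) + ajk * akj * cij * cik * sj * sk + tj * sj * cij * cik
      = - \<mu> * (cji * sj + cki * sk) * cij * cik"
    using i nz unfolding x y by (simp add: field_simps) algebra
  then have "sj * sk * r * (akj * cij - (cik * cki - cik * ckj - cki * cij)) = 0"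
    using mu unfolding tj' ti R_def M_def r_def by algebra
  then show "cij * akj = cik * cki - cik * ckj - cki * cij" using nz r0 by (simp add: mult.commute)
  show "(cij * cji - cij * cjk - cji * cik) * ti =
       cik * ajk * (cik * (cij * si - cji * sj + (ckj - cki) * sk)
          - (cij * cji - cij * cjk - cji * cik) * sj)"
    using mu unfolding ti R_def[symmetric] M_def[symmetric] r_def[symmetric] by algebra
qed

section \<open>Linear dependences between the rows of a mapped cube\<close>

lemma linear_combination4:
  fixes a1 :: real
  assumes "a1 = x * b1 + y * d1" "a2 = x * b2 + y * d2" "a3 = x * b3 + y * d3" "a4 = x * b4 + y * d4"
  shows "a1 * p1 + a2 * p2 + a3 * p3 + a4 * p4
    = x * (b1 * p1 + b2 * p2 + b3 * p3 + b4 * p4) + y * (d1 * p1 + d2 * p2 + d3 * p3 + d4 * p4)"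
  unfolding assms by (simp add: algebra_simps)

text \<open>The mapping with the denominators of the shifted \<open>c\<close> cleared. The
  right-hand sides agree in pairs; each is the coefficient of \<open>ui\<close>, \<open>uj\<close>
  or \<open>uk\<close>, up to sign, in the common form \<open>G\<close>.\<close>

locale mapped_cube =
  fixes cij cji cjk ckj cki cik si sj sk ti tj tk ajk akj aik aki aij aji :: real
  assumes nz: "cij \<noteq> 0" "cji \<noteq> 0" "cjk \<noteq> 0" "ckj \<noteq> 0" "cki \<noteq> 0" "cik \<noteq> 0"
    "si \<noteq> 0" "sj \<noteq> 0" "sk \<noteq> 0" "ti \<noteq> 0" "tj \<noteq> 0" "tk \<noteq> 0"
    "ajk \<noteq> 0" "akj \<noteq> 0" "aik \<noteq> 0" "aki \<noteq> 0" "aij \<noteq> 0" "aji \<noteq> 0"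
    and ajk: "cik * ajk = cij * cji - cij * cjk - cji * cik"
    and aik: "cjk * aik = cij * cji - cij * cjk - cji * cik"
    and akj: "cij * akj = cik * cki - cik * ckj - cki * cij"
    and aij: "ckj * aij = cik * cki - cik * ckj - cki * cij"
    and aki: "cji * aki = cjk * ckj - cjk * cki - ckj * cji"
    and aji: "cki * aji = cjk * ckj - cjk * cki - ckj * cji"
    and ti: "ti = cij * cik * si + cij * (cjk - cji) * sj + cik * (ckj - cki) * sk"
    and tj: "tj = cji * cjk * sj + cjk * (cki - ckj) * sk + cji * (cik - cij) * si"
    and tk: "tk = cki * ckj * sk + cki * (cij - cik) * si + ckj * (cji - cjk) * sj"
begin

text \<open>
  \<open>\<mu>k\<close> is the factor in \<open>ti * row i - tj * row j = \<mu>k * row u\<close>; the third factor is \<open>- (\<mu>j + \<mu>k)\<close>.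
  \<open>Fi\<close>, \<open>Fj\<close>, \<open>Fk\<close> are the forms of the faces \<open>jk\<close>, \<open>ki\<close>, \<open>ij\<close> at \<open>n\<close>, and \<open>Qi\<close>, \<open>Qj\<close>, \<open>Qk\<close> those of the
  opposite faces.
\<close>

definition "\<mu>j = cki * sk - cik * si + (cji - cjk) * sj"
definition "\<mu>k = cij * si - cji * sj + (ckj - cki) * sk"
definition "Ki = sj * cji + sk * cki"
definition "\<theta> = si * sj * cij * cji + sj * sk * cjk * ckj + si * sk * cik * cki"
definition "rj = cik * cki - cik * ckj - cki * cij"
definition "rk = cij * cji - cij * cjk - cji * cik"
definition "ri = cjk * ckj - cjk * cki - ckj * cji"

lemma a_eqs: "ajk = rk / cik" "aik = rk / cjk" "akj = rj / cij" "aij = rj / ckj"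
   "aki = ri / cji" "aji = ri / cki"
  using ajk aik akj aij aki aji nz unfolding ri_def rj_def rk_def by (simp_all add: field_simps)

lemma r_nz: "ri \<noteq> 0" "rj \<noteq> 0" "rk \<noteq> 0"
  using nz a_eqs by auto

text \<open>Each shifted \<open>s\<close> is written in two ways, so that a sum such as
  \<open>ti + rk * sj\<close> becomes a single product. This makes the coordinates of the rows
  collapse to simple fractions.\<close>

lemma t_eqs: "ti = cik * \<mu>k - rk * sj" "ti = - cij * \<mu>j - rj * sk"
  "tj = - cjk * \<mu>k - rk * si" "tj = - cji * (\<mu>j + \<mu>k) - ri * sk"
  "tk = ckj * \<mu>j - rj * si" "tk = cki * (\<mu>j + \<mu>k) - ri * sj"
  unfolding ti tj tk \<mu>j_def \<mu>k_def ri_def rj_def rk_def by algebra+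

text \<open>Up to sign, this sum is both the \<open>G\<close> coordinate of row \<open>jk\<close>
  and the \<open>Fi\<close> coordinate of row \<open>ijk\<close>.\<close>

lemma Ki_eq: "1 / (tj * aki) + 1 / (tk * aji) = - Ki / (tj * tk)"
proof -
  have "cji * tk + cki * tj = - (Ki * ri)" unfolding t_eqs(4,6) Ki_def by algebra
  then show ?thesis unfolding a_eqs using nz r_nz by (simp add: field_simps)
qed

text \<open>The \<open>Fj\<close> coordinate of row \<open>i\<close>; \<open>column_k_eq\<close>
  treats its \<open>Fk\<close> coordinate.\<close>

lemma column_j_eq: "1 / (sj * cik) + ajk / ti = \<mu>k / (ti * sj)"
proof -
  have "ti + rk * sj = cik * \<mu>k" unfolding t_eqs(1) by simp
  then show ?thesis using nz unfolding a_eqs by (simp add: field_simps)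
qed

lemma column_k_eq: "1 / (sk * cij) + akj / ti = - \<mu>j / (ti * sk)"
proof -
  have "ti + rj * sk = - cij * \<mu>j" unfolding t_eqs(2) by simp
  then show ?thesis using nz unfolding a_eqs by (simp add: field_simps)
qed

lemma row_u_coeffs:
  "Fk / sk + Fi / si + Fj / sj = (1 / si) * Fi + (1 / sj) * Fj + (1 / sk) * Fk + 0 * G"
  by simp

lemma row_i_coeffs:
  assumes "Qi = G - ajk * Fj - akj * Fk"
  shows "Fk / (sk * cij) + Fj / (sj * cik) - Qi / ti
    = 0 * Fi + (1 / (sj * cik) + ajk / ti) * Fj + (1 / (sk * cij) + akj / ti) * Fk + - (1 / ti) * G"
  unfolding assms by (simp add: algebra_simps diff_divide_distrib add_divide_distrib)

text \<open>Row \<open>u\<close> has no \<open>G\<close> coordinate and row \<open>i\<close> no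
  \<open>Fi\<close> coordinate, so \<open>G\<close> forces the multiplier \<open>ti / tj\<close> and
  \<open>Fi\<close> then forces \<open>- \<mu>k / tj\<close>. The coordinates \<open>Fj\<close> and
  \<open>Fk\<close> remain to be checked.\<close>

lemma row_j:
  assumes "Qi = G - ajk * Fj - akj * Fk" "Qj = G - aik * Fi - aki * Fk"
  shows "Fi / (si * cjk) + Fk / (sk * cji) - Qj / tj
    = - \<mu>k / tj * (Fk / sk + Fi / si + Fj / sj)
      + ti / tj * (Fk / (sk * cij) + Fj / (sj * cik) - Qi / ti)"
proof -
  have c1: "1 / (si * cjk) + aik / tj = - \<mu>k / tj * (1 / si) + ti / tj * 0"
  proof -
    have "tj + rk * si = - cjk * \<mu>k" unfolding t_eqs(3) by simp
    then show ?thesis using nz unfolding a_eqs by (simp add: field_simps)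
  qed
  have c2: "0 = - \<mu>k / tj * (1 / sj) + ti / tj * (1 / (sj * cik) + ajk / ti)"
    unfolding column_j_eq using nz by (simp add: field_simps)
  have c3: "1 / (sk * cji) + aki / tj
      = - \<mu>k / tj * (1 / sk) + ti / tj * (1 / (sk * cij) + akj / ti)"
  proof -
    have "tj + ri * sk = - cji * (\<mu>j + \<mu>k)"
      unfolding t_eqs(4) by simp
    moreover have "1 / (sk * cji) + aki / tj = (tj + ri * sk) / (sk * cji * tj)"
      using nz unfolding a_eqs by (simp add: field_simps)
    ultimately have E: "1 / (sk * cji) + aki / tj = - (\<mu>j + \<mu>k) / (sk * tj)"
      using nz by (simp add: minus_divide_left)
    show ?thesis unfolding E column_k_eq using nz by (simp add: field_simps)
  qed
  have c4: "- (1 / tj) = - \<mu>k / tj * 0 + ti / tj * - (1 / ti)"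
    using nz by simp
  have c5: "Fi / (si * cjk) + Fk / (sk * cji) - Qj / tj
      = (1 / (si * cjk) + aik / tj) * Fi + 0 * Fj + (1 / (sk * cji) + aki / tj) * Fk + - (1 / tj) * G"
    using nz unfolding assms by (simp add: algebra_simps diff_divide_distrib add_divide_distrib)
  show ?thesis
    unfolding c5 row_u_coeffs[of Fk Fi Fj G] row_i_coeffs[OF assms(1), of Fi]
    by (rule linear_combination4[OF c1 c2 c3 c4])
qed

text \<open>The \<open>G\<close> coordinate, evaluated by \<open>Ki_eq\<close>, gives the multiplier
  of row \<open>i\<close>; the \<open>Fj\<close> coordinate then gives that of row
  \<open>u\<close>.\<close>

lemma row_jk:
  assumes "Qi = G - ajk * Fj - akj * Fk" "Qj = G - aik * Fi - aki * Fk" "Qk = G - aij * Fi - aji * Fj"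
  shows "- Fi / (si * cjk * ckj) - Qj / (tj * aki) - Qk / (tk * aji)
    = (sj / tk + \<mu>k * Ki / (tj * tk)) * (Fk / sk + Fi / si + Fj / sj)
      + - (ti * Ki / (tj * tk)) * (Fk / (sk * cij) + Fj / (sj * cik) - Qi / ti)"
proof -
  let ?a = "sj / tk + \<mu>k * Ki / (tj * tk)" and ?b = "- (ti * Ki / (tj * tk))"
  have c1: "- (1 / (si * cjk * ckj)) + aik / (tj * aki) + aij / (tk * aji) = ?a * (1 / si) + ?b * 0"
  proof -
    have "- tj * tk * ri + si * tk * rk * cji * ckj + si * tj * rj * cki * cjk
       = cjk * ckj * ri * (sj * tj + \<mu>k * Ki)"
      unfolding tj tk \<mu>k_def Ki_def ri_def rj_def rk_def by algebra
    then show ?thesis using nz r_nz unfolding a_eqs by (simp add: field_simps)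
  qed
  have c2: "1 / tk = ?a * (1 / sj) + ?b * (1 / (sj * cik) + ajk / ti)"
    unfolding column_j_eq using nz by (simp add: field_simps)
  have c3: "1 / tj = ?a * (1 / sk) + ?b * (1 / (sk * cij) + akj / ti)"
  proof -
    have "sk * tk = sj * tj + (\<mu>k + \<mu>j) * Ki"
      unfolding t_eqs(4,6) Ki_def by algebra
    then show ?thesis unfolding column_k_eq using nz by (simp add: field_simps)
  qed
  have c4: "- (1 / (tj * aki) + 1 / (tk * aji)) = ?a * 0 + ?b * - (1 / ti)"
    unfolding Ki_eq using nz by simp
  have c5: "- Fi / (si * cjk * ckj) - Qj / (tj * aki) - Qk / (tk * aji)
      = (- (1 / (si * cjk * ckj)) + aik / (tj * aki) + aij / (tk * aji)) * Fi + (1 / tk) * Fj + (1 / tj) * Fk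
        + (- (1 / (tj * aki) + 1 / (tk * aji))) * G"
    using nz unfolding assms by (simp add: algebra_simps diff_divide_distrib add_divide_distrib)
  show ?thesis
    unfolding c5 row_u_coeffs[of Fk Fi Fj G] row_i_coeffs[OF assms(1), of Fi]
    by (rule linear_combination4[OF c1 c2 c3 c4])
qed

text \<open>The \<open>Fi\<close> coordinate gives the multiplier of row \<open>u\<close> by
  \<open>Ki_eq\<close>. The \<open>G\<close> coordinate equals
  \<open>\<theta> / (ti * tj * tk)\<close>, which is invariant under rotation of the directions and
  gives the multiplier of row \<open>i\<close>.\<close>

lemma row_ijk:
  assumes "Qi = G - ajk * Fj - akj * Fk" "Qj = G - aik * Fi - aki * Fk" "Qk = G - aij * Fi - aji * Fj"
  shows "Qi / (ti * ajk * akj) + Qj / (tj * aki * aik) + Qk / (tk * aij * aji)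
    = (si * Ki / (tj * tk)) * (Fk / sk + Fi / si + Fj / sj)
      + - (\<theta> / (tj * tk)) * (Fk / (sk * cij) + Fj / (sj * cik) - Qi / ti)"
proof -
  let ?a = "si * Ki / (tj * tk)" and ?b = "- (\<theta> / (tj * tk))"
  have c1: "- (1 / (tj * aki) + 1 / (tk * aji)) = ?a * (1 / si) + ?b * 0"
    unfolding Ki_eq using nz by simp
  have c2: "- (1 / (ti * akj) + 1 / (tk * aij)) = ?a * (1 / sj) + ?b * (1 / (sj * cik) + ajk / ti)"
  proof -
    have "- (tk * cij + ti * ckj) = rj * (si * cij + sk * ckj)"
      unfolding t_eqs(2,5) by algebra
    moreover have "- (1 / (ti * akj) + 1 / (tk * aij)) = - (tk * cij + ti * ckj) / (ti * tk * rj)"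
      using nz r_nz unfolding a_eqs by (simp add: field_simps)
    ultimately have E: "- (1 / (ti * akj) + 1 / (tk * aij)) = (si * cij + sk * ckj) / (ti * tk)"
      using r_nz by simp
    have "si * ti * Ki - \<mu>k * \<theta> = sj * tj * (si * cij + sk * ckj)"
      unfolding ti tj \<mu>k_def Ki_def \<theta>_def by algebra
    then have "(si * ti * Ki - \<mu>k * \<theta>) / (sj * tj * (ti * tk)) = (si * cij + sk * ckj) / (ti * tk)"
      using nz by simp
    moreover have "?a * (1 / sj) + ?b * (\<mu>k / (ti * sj)) = (si * ti * Ki - \<mu>k * \<theta>) / (sj * tj * (ti * tk))"
      using nz by (simp add: field_simps)
    ultimately show ?thesis unfolding E column_j_eq by simp
  qed
  have c3: "- (1 / (ti * ajk) + 1 / (tj * aik)) = ?a * (1 / sk) + ?b * (1 / (sk * cij) + akj / ti)"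
  proof -
    have "- (tj * cik + ti * cjk) = rk * (si * cik + sj * cjk)"
      unfolding t_eqs(1,3) by algebra
    moreover have "- (1 / (ti * ajk) + 1 / (tj * aik)) = - (tj * cik + ti * cjk) / (ti * tj * rk)"
      using nz r_nz unfolding a_eqs by (simp add: field_simps)
    ultimately have E: "- (1 / (ti * ajk) + 1 / (tj * aik)) = (si * cik + sj * cjk) / (ti * tj)"
      using r_nz by simp
    have "si * ti * Ki + \<mu>j * \<theta> = sk * tk * (si * cik + sj * cjk)"
      unfolding ti tk \<mu>j_def Ki_def \<theta>_def by algebra
    then have "(si * ti * Ki + \<mu>j * \<theta>) / (sk * tk * (ti * tj)) = (si * cik + sj * cjk) / (ti * tj)"
      using nz by simp
    moreover have "?a * (1 / sk) + ?b * (- \<mu>j / (ti * sk)) = (si * ti * Ki + \<mu>j * \<theta>) / (sk * tk * (ti * tj))"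
      using nz by (simp add: field_simps)
    ultimately show ?thesis unfolding E column_k_eq by simp
  qed
  have c4: "1 / (ti * ajk * akj) + 1 / (tj * aki * aik) + 1 / (tk * aij * aji)
      = ?a * 0 + ?b * - (1 / ti)"
  proof -
    have "tj * tk * cij * cik * ri + ti * tk * cji * cjk * rj + ti * tj * cki * ckj * rk
        = ri * rj * rk * \<theta>"
      unfolding ti tj tk \<theta>_def ri_def rj_def rk_def by algebra
    then show ?thesis using nz r_nz unfolding a_eqs by (simp add: field_simps)
  qed
  have c5: "Qi / (ti * ajk * akj) + Qj / (tj * aki * aik) + Qk / (tk * aij * aji)
      = (- (1 / (tj * aki) + 1 / (tk * aji))) * Fi + (- (1 / (ti * akj) + 1 / (tk * aij))) * Fj
        + (- (1 / (ti * ajk) + 1 / (tj * aik))) * Fk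
        + (1 / (ti * ajk * akj) + 1 / (tj * aki * aik) + 1 / (tk * aij * aji)) * G"
    using nz unfolding assms by (simp add: algebra_simps diff_divide_distrib add_divide_distrib)
  show ?thesis
    unfolding c5 row_u_coeffs[of Fk Fi Fj G] row_i_coeffs[OF assms(1), of Fi]
    by (rule linear_combination4[OF c1 c2 c3 c4])
qed

text \<open>Three-dimensional consistency of the face equations: adding multiples of the forms at
  \<open>n\<close> removes \<open>uij\<close>, \<open>ujk\<close>, \<open>uik\<close> from each
  opposite face, and the three results are the same form \<open>G\<close> in \<open>u\<close>,
  \<open>ui\<close>, \<open>uj\<close>, \<open>uk\<close>, \<open>uijk\<close>.\<close>

lemma opposite_face_relations:
  fixes u ui uj uk uij ujk uik uijk :: real
  defines "Fk \<equiv> uij - cji * ui - cij * uj - cij * cji * u"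
    and "Fi \<equiv> ujk - ckj * uj - cjk * uk - cjk * ckj * u"
    and "Fj \<equiv> uik - cik * uk - cki * ui - cki * cik * u"
    and "Qk \<equiv> uijk - aji * uik - aij * ujk - aij * aji * uk"
    and "Qi \<equiv> uijk - akj * uij - ajk * uik - ajk * akj * ui"
    and "Qj \<equiv> uijk - aik * ujk - aki * uij - aki * aik * uj"
  shows "Qj = (Qi + ajk * Fj + akj * Fk) - aik * Fi - aki * Fk" (is ?t1)
    and "Qk = (Qi + ajk * Fj + akj * Fk) - aij * Fi - aji * Fj" (is ?t2)
proof -
  define G where "G = uijk - ri * ui - rj * uj - rk * uk - (rk * cki + rj * cji) * u"
  have *: "ajk * cik = rk" "aik * cjk = rk" "akj * cij = rj" "aij * ckj = rj"
     "aki * cji = ri" "aji * cki = ri"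
    using nz unfolding a_eqs by auto
  \<comment> \<open>The three eliminations yield three expressions for the coefficient of
    \<open>u\<close>; they coincide.\<close>
  have D: "rk * cki + rj * cji = rk * ckj + ri * cij" "rk * cki + rj * cji = ri * cik + rj * cjk"
    unfolding ri_def rj_def rk_def by algebra+
  have i: "ajk * akj + ajk * cki + akj * cji = ri"
  proof -
    have "rk * rj + rk * cki * cij + rj * cji * cik = ri * cik * cij"
      unfolding ri_def rj_def rk_def by algebra
    then show ?thesis using nz unfolding a_eqs by (simp add: field_simps)
  qed
  have j: "aik * aki + aik * ckj + aki * cij = rj"
  proof -
    have "rk * ri + rk * ckj * cji + ri * cij * cjk = rj * cjk * cji"
      unfolding ri_def rj_def rk_def by algebra
    then show ?thesis using nz unfolding a_eqs by (simp add: field_simps)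
  qed
  have k: "aij * aji + aij * cjk + aji * cik = rk"
  proof -
    have "rj * ri + rj * cjk * cki + ri * cik * ckj = rk * ckj * cki"
      unfolding ri_def rj_def rk_def by algebra
    then show ?thesis using nz unfolding a_eqs by (simp add: field_simps)
  qed
  have "Qi + ajk * Fj + akj * Fk = uijk - (ajk * akj + ajk * cki + akj * cji) * ui
      - (akj * cij) * uj - (ajk * cik) * uk - ((ajk * cik) * cki + (akj * cij) * cji) * u"
    unfolding Qi_def Fj_def Fk_def by (simp add: algebra_simps)
  then have "Qi + ajk * Fj + akj * Fk = G" unfolding i * G_def .
  moreover have "Qj + aik * Fi + aki * Fk = uijk - (aki * cji) * ui
      - (aik * aki + aik * ckj + aki * cij) * uj - (aik * cjk) * uk
      - ((aik * cjk) * ckj + (aki * cji) * cij) * u"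
    unfolding Qj_def Fi_def Fk_def by (simp add: algebra_simps)
  then have "Qj + aik * Fi + aki * Fk = G" unfolding j * G_def D(1) .
  moreover have "Qk + aij * Fi + aji * Fj = uijk - (aji * cki) * ui - (aij * ckj) * uj
      - (aij * aji + aij * cjk + aji * cik) * uk - ((aji * cki) * cik + (aij * ckj) * cjk) * u"
    unfolding Qk_def Fi_def Fj_def by (simp add: algebra_simps)
  then have "Qk + aij * Fi + aji * Fj = G" unfolding k * G_def D(2) .
  ultimately show ?t1 ?t2 by simp_all
qed

end

section \<open>Commutation of two shifts\<close>

text \<open>Both double shifts can be written over the denominator \<open>r k l j\<close>, since
  \<open>r\<close> is symmetric in its first two arguments. The remaining numerators are then
  compared.\<close>

lemma c_shift_commute:
  assumes nz: "\<And>i j. i \<noteq> j \<Longrightarrow> c i j \<noteq> 0"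
    and nz': "\<And>i j k. distinct [i, j, k] \<Longrightarrow> c_shift c k i j \<noteq> 0"
    and d: "distinct [i, j, k, l]"
  shows "c_shift (c_shift c l) k i j = c_shift (c_shift c k) l i j"
proof -
  define r where "r a b m = c a b * c b a - c a b * c b m - c b a * c a m" for a b m
  have sh: "c_shift c b a m = r a b m / c b m" for a b m
    by (simp add: c_shift_def r_def)
  have nz2: "r k l j \<noteq> 0" "r l k j \<noteq> 0"
    using nz'[of k j l] nz'[of l j k] d by (auto simp: sh)
  have rsym: "r a b m = r b a m" for a b m by (simp add: r_def)
  have n: "c l j \<noteq> 0" "c k j \<noteq> 0" "c l k \<noteq> 0" "c l i \<noteq> 0" "c k l \<noteq> 0" "c k i \<noteq> 0" using nz d by auto
  \<comment> \<open>This quadratic relation replaces a product of two numerators by terms linear in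
    \<open>r\<close>.\<close>
  have prod: "r a m b * r m b a = c m b * c m a * r a b m - c m b * c a m * r m b a - c m a * c b m * r a m b"
    for a b m unfolding r_def by algebra
  have eq: "c_shift (c_shift c l) k i j =
     (c l j * (r i k l - c i l * r k l i / c l i - c k l * r i l k / c l k)
        - r i l k * r k l j / c l k - r k l i * r i l j / c l i) / r k l j"
    if "c l j \<noteq> 0" "c l k \<noteq> 0" "c l i \<noteq> 0" "r k l j \<noteq> 0" for k l
  proof -
    have "r i l k * r k l i = c l k * c l i * r i k l - c l k * c i l * r k l i - c l i * c k l * r i l k"
      using prod[of i l k] rsym[of l k] by simp
    then have "r i l k * r k l i / (c l k * c l i) = r i k l - c i l * r k l i / c l i - c k l * r i l k / c l k"
      using that by (simp add: field_simps)
    moreover have "c_shift (c_shift c l) k i j =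
       (c l j * (r i l k * r k l i / (c l k * c l i))
          - r i l k * r k l j / c l k - r k l i * r i l j / c l i) / r k l j"
      unfolding c_shift_def[of "c_shift c l"] unfolding sh using that by (simp add: field_simps)
    ultimately show ?thesis by simp
  qed
  show ?thesis
    unfolding eq[of l k, OF n(1,3,4) nz2(1)] eq[of k l, OF n(2,5,6) nz2(2)] rsym[of l k]
    using n by (intro arg_cong[where f = "\<lambda>x. x / r k l j"], simp add: field_simps)
      (unfold r_def, algebra)
qed

text \<open>Antisymmetry reduces both sides to combinations of the same six values of
  \<open>s\<close>, one for each pair of directions; the coefficients are compared one by
  one.\<close>

lemma s_shift_commute:
  assumes nz: "\<And>i j. i \<noteq> j \<Longrightarrow> c i j \<noteq> 0"
    and anti: "\<And>i j. i \<noteq> j \<Longrightarrow> s i j = - s j i"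
    and d: "distinct [i, j, k, l]"
  shows "s_shift (c_shift c l) (s_shift c s l) k i j = s_shift (c_shift c k) (s_shift c s k) l i j"
proof -
  define r where "r a b m = c a b * c b a - c a b * c b m - c b a * c a m" for a b m
  \<comment> \<open>Up to the factor \<open>c l i / (c l j * c l k)\<close>, this is the difference
    of \<open>c i j\<close> and \<open>c i k\<close> after the shift by \<open>l\<close>; such
    differences are what \<open>s_shift\<close> contains.\<close>
  define e where "e i j k l = c i l * (c l k - c l j) - c i j * c l k + c i k * c l j" for i j k l
  have sh: "c_shift c b a m = r a b m / c b m" for a b m
    by (simp add: c_shift_def r_def)
  have eq: "s_shift (c_shift c l) (s_shift c s l) k i j =
     r k l i * r k l j * s i j + r k l i * e i j k l * s j k + r k l j * e j i k l * s k i
     + r k l j * ((r k l i * (c j i - c j l) - e j i k l * (c k i - c k l)) / c l i) * s l i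
     + r k l i * ((e i j k l * (c k j - c k l) - r k l j * (c i j - c i l)) / c l j) * s l j
     + (r k l i * e i j k l * (c j k - c j l) - r k l j * e j i k l * (c i k - c i l)) / c l k * s k l"
    if d: "distinct [i, j, k, l]" for k l
  proof -
    have n: "c l j \<noteq> 0" "c l k \<noteq> 0" "c l i \<noteq> 0" using nz d by auto
    have a: "s j l = - s l j" "s i l = - s l i" "s l k = - s k l"
      using anti d by auto
    have diff: "c_shift c l i j - c_shift c l i k = c l i * e i j k l / (c l j * c l k)"
      if "c l j \<noteq> 0" "c l k \<noteq> 0" for i j
      using that n unfolding sh r_def e_def by (simp add: field_simps)
    show ?thesis
      unfolding s_shift_def[of "c_shift c l"] diff[OF n(1,2)] diff[OF n(3,2)]
      unfolding sh s_shift_def a using n by (simp add: field_simps)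
  qed
  have rsym: "r a b m = r b a m" for a b m by (simp add: r_def)
  have n: "c l j \<noteq> 0" "c k j \<noteq> 0" "c l k \<noteq> 0" "c l i \<noteq> 0" "c k l \<noteq> 0" "c k i \<noteq> 0" using nz d by auto
  have *: "(r k l i * (c j i - c j l) - e j i k l * (c k i - c k l)) / c l i = e j i l k"
    if "c l i \<noteq> 0" for k l i j
  proof -
    have "r k l i * (c j i - c j l) - e j i k l * (c k i - c k l) = e j i l k * c l i"
      unfolding r_def e_def by algebra
    then show ?thesis using that by (simp add: field_simps)
  qed
  have **: "(e i j k l * (c k j - c k l) - r k l j * (c i j - c i l)) / c l j = - e i j l k"
    if "c l j \<noteq> 0" for k l i j
  proof -
    have "e i j k l * (c k j - c k l) - r k l j * (c i j - c i l) = - e i j l k * c l j"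
      unfolding r_def e_def by algebra
    then show ?thesis using that by (simp add: field_simps)
  qed
  \<comment> \<open>The coefficient of \<open>s k l\<close> changes sign when \<open>k\<close> and
    \<open>l\<close> are exchanged, as \<open>s k l\<close> itself does.\<close>
  have "(r k l i * e i j k l * (c j k - c j l) - r k l j * e j i k l * (c i k - c i l)) * c k l
     = - (r k l i * e i j l k * (c j l - c j k) - r k l j * e j i l k * (c i l - c i k)) * c l k"
    unfolding r_def e_def by algebra
  then have ***: "(r k l i * e i j k l * (c j k - c j l) - r k l j * e j i k l * (c i k - c i l)) / c l k
     = - ((r k l i * e i j l k * (c j l - c j k) - r k l j * e j i l k * (c i l - c i k)) / c k l)"
    using n by (simp add: field_simps)
  have d': "distinct [i, j, l, k]" using d by auto
  have a: "s l k = - s k l" "s k j = - s j k" "s l j = - s j l" "s i k = - s k i" "s i l = - s l i"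
    using anti d by auto
  show ?thesis
    unfolding eq[OF d] eq[OF d'] rsym[of l k] *[OF n(4)]
      *[where i = i and j = j and k = l and l = k, OF n(6), unfolded rsym[of l k]] **[OF n(1)]
      **[where i = i and j = j and k = l and l = k, OF n(2), unfolded rsym[of l k]] *** a
    by (simp add: algebra_simps)
qed

section \<open>Corner equations as combinations of face forms\<close>

definition face where
  "face c i j n u = u (n + ev i + ev j) - c n j i * u (n + ev i) - c n i j * u (n + ev j)
     - c n i j * c n j i * u n" for c :: "'d::finite lattice \<Rightarrow> 'd coeffs"

text \<open>Evaluating a linear form at this unit field reads off one of its coefficients.\<close>

definition delta :: "'a \<Rightarrow> 'a \<Rightarrow> real" where
  "delta w v = (if v = w then 1 else 0)"

text \<open>An \<open>f\<close> in \<open>S\<close> outside the span of \<open>a\<close> and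
  \<open>b\<close> would give three independent elements in the span of a two-element basis.
  Conversely, \<open>a\<close> and \<open>b\<close> form a basis.\<close>

lemma rank_two_iff:
  fixes a b :: "'a \<Rightarrow> real"
  assumes "a \<in> S" "b \<in> S" and ind: "\<And>x y. (\<And>v. x * a v + y * b v = 0) \<Longrightarrow> x = 0 \<and> y = 0"
  shows "functionals.dim S = 2 \<longleftrightarrow> (\<forall>f\<in>S. \<exists>x y. \<forall>v. f v = x * a v + y * b v)"
proof -
  have span: "f \<in> functionals.span {a, b} \<longleftrightarrow> (\<exists>x y. \<forall>v. f v = x * a v + y * b v)" for f
    by (auto simp: functionals.span_insert functionals.span_singleton fun_eq_iff image_iff algebra_simps)
  have ab: "a \<noteq> b" using ind[of 1 "-1"] by auto
  have "a \<noteq> 0" using ind[of 1 0] by auto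
  have "b \<notin> functionals.span {a}"
  proof
    assume "b \<in> functionals.span {a}"
    then obtain x where "b = (\<lambda>v. x * a v)" by (auto simp: functionals.span_singleton)
    then show False using ind[of x "-1"] by auto
  qed
  then have indep: "functionals.independent {a, b}"
    using \<open>a \<noteq> 0\<close> ab functionals.independent_insertI[of b "{a}"]
    by (simp add: insert_commute functionals.dependent_single)
  show ?thesis
  proof
    assume dim: "functionals.dim S = 2"
    obtain B where B: "functionals.independent B" "S \<subseteq> functionals.span B" "card B = 2"
      using functionals.basis_exists[of S] dim by metis
    show "\<forall>f\<in>S. \<exists>x y. \<forall>v. f v = x * a v + y * b v"
    proof (rule ballI, rule ccontr)
      fix f assume f: "f \<in> S" "\<nexists>x y. \<forall>v. f v = x * a v + y * b v"
      then have nf: "f \<notin> functionals.span {a, b}" using span by blast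
      then have "functionals.independent {f, a, b}"
        using indep by (rule functionals.independent_insertI)
      moreover have "{f, a, b} \<subseteq> functionals.span B" using f B assms by auto
      moreover have "finite B" using B(3) card.infinite by fastforce
      ultimately have "card {f, a, b} \<le> card B" using functionals.independent_span_bound by blast
      moreover have "f \<noteq> a" "f \<noteq> b" using nf functionals.span_base by blast+
      ultimately show False using ab B(3) by simp
    qed
  next
    assume "\<forall>f\<in>S. \<exists>x y. \<forall>v. f v = x * a v + y * b v"
    then have "S \<subseteq> functionals.span {a, b}" using span by blast
    then show "functionals.dim S = 2"
      using functionals.dim_unique[of "{a, b}" S 2] indep assms ab by auto
  qed
qed

lemma face_upd: "face c i j n (u(w := t)) = face c i j n u + (t - u w) * face c i j n (delta w)"
  by (simp add: face_def delta_def algebra_simps)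

lemma lagrangian_face:
  "lagrangian c s i j n u = (face c i j n u)\<^sup>2 / (2 * s n i j * c n i j * c n j i)"
  by (simp add: lagrangian_def face_def)

lemma lagrangian_deriv:
  "((\<lambda>t. lagrangian c s i j n (u(w := t))) has_real_derivative
     face c i j n u * face c i j n (delta w) / (s n i j * c n i j * c n j i)) (at (u w))"
  unfolding lagrangian_face face_upd divide_inverse
  by (auto intro!: derivative_eq_intros simp: algebra_simps)

text \<open>Differentiating the square of a linear form gives twice the form times a coefficient, so
  every corner equation is a combination of the six face forms.\<close>

lemma corner_expr_eq:
  "corner_expr c s i j k n w u =
     (let D = (\<lambda>i j n. face c i j n u * face c i j n (delta w) / (s n i j * c n i j * c n j i))
      in (D i j (n + ev k) - D i j n) + (D j k (n + ev i) - D j k n) + (D k i (n + ev j) - D k i n))"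
  unfolding corner_expr_def cube_action_def Let_def
  by (intro DERIV_imp_deriv derivative_intros lagrangian_deriv)

lemma corner_expr_rotate: "corner_expr c s j k i n w = corner_expr c s i j k n w"
  by (simp add: fun_eq_iff corner_expr_eq Let_def)

lemma distinct_vertices:
  fixes n :: "'d::finite lattice"
  assumes "distinct [i, j, k]"
  shows "distinct [n, n + ev i, n + ev j, n + ev k, n + ev i + ev j, n + ev j + ev k,
                   n + ev i + ev k, n + ev i + ev j + ev k]"
proof -
  \<comment> \<open>The offsets from \<open>n\<close> in the three directions run through the eight
    0-1 triples.\<close>
  have "distinct (map (\<lambda>v. (v $ i - n $ i, v $ j - n $ j, v $ k - n $ k))
      [n, n + ev i, n + ev j, n + ev k, n + ev i + ev j, n + ev j + ev k,
                   n + ev i + ev k, n + ev i + ev j + ev k])"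
    using assms by (auto simp: axis_def)
  then show ?thesis unfolding distinct_map by blast
qed

lemma vertex_swap: "n + ev i + ev j = n + ev j + ev i"
  by (simp add: ac_simps)

lemma vertex_rotate: "n + ev i + ev j + ev k = n + ev k + ev i + ev j"
  by (simp add: ac_simps)

lemma face_delta:
  fixes c :: "'d::finite lattice \<Rightarrow> 'd coeffs"
  assumes d: "distinct [i, j, k]"
  shows
    "face c i j n (delta n) = - (c n i j * c n j i)"
    "face c i j n (delta (n + ev i)) = - c n j i"
    "face c i j n (delta (n + ev j)) = - c n i j"
    "face c i j n (delta (n + ev i + ev j)) = 1"
    "face c i j n (delta (n + ev k)) = 0"
    "face c i j n (delta (n + ev i + ev k)) = 0"
    "face c i j n (delta (n + ev j + ev k)) = 0"
    "face c i j n (delta (n + ev i + ev j + ev k)) = 0"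
    "face c i j (n + ev k) (delta (n + ev k)) = - (c (n + ev k) i j * c (n + ev k) j i)"
    "face c i j (n + ev k) (delta (n + ev i + ev k)) = - c (n + ev k) j i"
    "face c i j (n + ev k) (delta (n + ev j + ev k)) = - c (n + ev k) i j"
    "face c i j (n + ev k) (delta (n + ev i + ev j + ev k)) = 1"
    "face c i j (n + ev k) (delta n) = 0"
    "face c i j (n + ev k) (delta (n + ev i)) = 0"
    "face c i j (n + ev k) (delta (n + ev j)) = 0"
    "face c i j (n + ev k) (delta (n + ev i + ev j)) = 0"
  using distinct_vertices[OF d, of n]
  by (simp_all only: face_def delta_def vertex_swap[of n k] vertex_rotate[of n i j k, symmetric])
    (auto simp: ac_simps)

section \<open>Rank two and the mapping\<close>

definition spanned where
  "spanned f a b \<longleftrightarrow> (\<exists>x y :: real. \<forall>v. f v = x * a v + y * b v)" for f a b :: "'a \<Rightarrow> real"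

lemma spanned_trans:
  assumes "spanned f a b" "spanned b a d"
  shows "spanned f a d"
proof -
  obtain x y x' y' where "\<And>v. f v = x * a v + y * b v" "\<And>v. b v = x' * a v + y' * d v"
    using assms unfolding spanned_def by metis
  then have "f v = (x + y * x') * a v + (y * y') * d v" for v by (simp add: algebra_simps)
  then show ?thesis unfolding spanned_def by blast
qed

locale lattice_coeffs =
  fixes c s :: "'d::finite lattice \<Rightarrow> 'd coeffs"
  assumes c_nz: "i \<noteq> j \<Longrightarrow> c n i j \<noteq> 0"
    and s_nz: "i \<noteq> j \<Longrightarrow> s n i j \<noteq> 0"
begin

text \<open>These four corners represent all eight up to rotation of the directions.\<close>

lemma corner_exprs:
  assumes d: "distinct [i, j, k]"
  shows "corner_expr c s i j k n n u =
      face c i j n u / s n i j + face c j k n u / s n j k + face c k i n u / s n k i" (is ?t1)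
    and "corner_expr c s i j k n (n + ev i) u =
      face c i j n u / (s n i j * c n i j) + face c k i n u / (s n k i * c n i k)
      - face c j k (n + ev i) u / s (n + ev i) j k" (is ?t2)
    and "corner_expr c s i j k n (n + ev j + ev k) u =
      - face c j k n u / (s n j k * c n j k * c n k j)
      - face c k i (n + ev j) u / (s (n + ev j) k i * c (n + ev j) k i)
      - face c i j (n + ev k) u / (s (n + ev k) i j * c (n + ev k) j i)" (is ?t3)
    and "corner_expr c s i j k n (n + ev i + ev j + ev k) u =
      face c j k (n + ev i) u / (s (n + ev i) j k * c (n + ev i) j k * c (n + ev i) k j)
      + face c k i (n + ev j) u / (s (n + ev j) k i * c (n + ev j) k i * c (n + ev j) i k)
      + face c i j (n + ev k) u / (s (n + ev k) i j * c (n + ev k) i j * c (n + ev k) j i)"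
      (is ?t4)
proof -
  have d': "distinct [j, k, i]" "distinct [k, i, j]" using d by auto
  have nz: "c m i j \<noteq> 0" "c m j i \<noteq> 0" "c m i k \<noteq> 0" "c m k i \<noteq> 0" "c m j k \<noteq> 0" "c m k j \<noteq> 0"
    "s m i j \<noteq> 0" "s m j k \<noteq> 0" "s m k i \<noteq> 0" for m
    using d c_nz s_nz by auto
  note e = vertex_swap[of n j i] vertex_swap[of n k i] vertex_swap[of n k j]
    vertex_rotate[of n j k i] vertex_swap[of "n + ev i" k j]
  note f = face_delta[OF d, of c n, unfolded e] face_delta[OF d'(1), of c n, unfolded e]
    face_delta[OF d'(2), of c n, unfolded e]
  show ?t1 ?t2 ?t3 ?t4
    unfolding corner_expr_eq Let_def f using nz by simp_all
qed

lemma corner_rank_iff: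
  assumes d: "distinct [i, j, k]"
  shows "corner_rank c s i j k n = 2 \<longleftrightarrow>
    (\<forall>w\<in>cube_vertices i j k n. spanned (corner_expr c s i j k n w)
       (corner_expr c s i j k n n) (corner_expr c s i j k n (n + ev i)))"
proof -
  have d': "distinct [j, k, i]" "distinct [k, i, j]" using d by auto
  note e = vertex_swap[of n j i] vertex_swap[of n k i] vertex_swap[of n k j]
    vertex_rotate[of n j k i] vertex_swap[of "n + ev i" k j]
  note f = face_delta[OF d, of c n, unfolded e] face_delta[OF d'(1), of c n, unfolded e]
    face_delta[OF d'(2), of c n, unfolded e]
  have ind: "x = 0 \<and> y = 0"
    if xy: "\<And>u. x * corner_expr c s i j k n n u + y * corner_expr c s i j k n (n + ev i) u = 0" for x y
  proof -
    \<comment> \<open>Of the two rows, only the one at \<open>n + ev i\<close> involves the vertex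
      opposite to \<open>n\<close>.\<close>
    have "y = 0"
      using xy[of "delta (n + ev i + ev j + ev k)"] d s_nz[of j k "n + ev i"]
      unfolding corner_exprs[OF d] f by simp
    moreover have "x / s n i j = 0"
      using xy[of "delta (n + ev i + ev j)"] \<open>y = 0\<close> unfolding corner_exprs[OF d] f by simp
    ultimately show ?thesis using d s_nz[of i j n] by simp
  qed
  show ?thesis
    unfolding corner_rank_def spanned_def
    by (subst rank_two_iff[OF _ _ ind]) (auto simp only: cube_vertices_def image_insert insert_iff ball_simps)
qed

section \<open>Rank two implies the mapping\<close>

lemma consistent_imp_shift_eqs:
  assumes "consistent c s" and d: "distinct [i, j, k]"
  shows "c (n + ev i) k j = c_shift (c n) i k j"
    and "(c n i j * c n j i - c n i j * c n j k - c n j i * c n i k) * s (n + ev i) j k =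
       c n i k * c (n + ev i) j k * (c n i k * (c n i j * s n j k - c n j i * s n k i
         + (c n k j - c n k i) * s n i j)
          - (c n i j * c n j i - c n i j * c n j k - c n j i * c n i k) * s n k i)"
proof -
  have d': "distinct [j, k, i]" "distinct [k, i, j]" using d by auto
  note e = vertex_swap[of n j i] vertex_swap[of n k i] vertex_swap[of n k j]
    vertex_rotate[of n j k i] vertex_swap[of "n + ev i" k j]
  note f = face_delta[OF d, of c n, unfolded e] face_delta[OF d'(1), of c n, unfolded e]
    face_delta[OF d'(2), of c n, unfolded e]
  have nz: "c m i j \<noteq> 0" "c m j i \<noteq> 0" "c m i k \<noteq> 0" "c m k i \<noteq> 0" "c m j k \<noteq> 0" "c m k j \<noteq> 0"
    "s m i j \<noteq> 0" "s m j k \<noteq> 0" "s m k i \<noteq> 0" for m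
    using d c_nz s_nz by auto
  have "spanned (corner_expr c s i j k n (n + ev j))
       (corner_expr c s i j k n n) (corner_expr c s i j k n (n + ev i))"
    using assms corner_rank_iff[OF d] unfolding consistent_def cube_vertices_def by blast
  then obtain x y where xy: "\<And>u. corner_expr c s j k i n (n + ev j) u
       = x * corner_expr c s i j k n n u + y * corner_expr c s i j k n (n + ev i) u"
    unfolding spanned_def corner_expr_rotate[of c s j k i] by blast
  note xy = xy[unfolded corner_exprs[OF d] corner_exprs[OF d'(1)]]
  \<comment> \<open>Unit fields at six vertices extract the columns needed.\<close>
  have ijk: "- (1 / s (n + ev j) k i) = y * - (1 / s (n + ev i) j k)"
    using xy[of "delta (n + ev i + ev j + ev k)"] unfolding f by simp
  have jk: "1 / (s n j k * c n j k) + c (n + ev j) i k / s (n + ev j) k i = x / s n j k"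
    using xy[of "delta (n + ev j + ev k)"] unfolding f by simp
  have ik: "0 = x / s n k i + y * (1 / (s n k i * c n i k) + c (n + ev i) j k / s (n + ev i) j k)"
    using xy[of "delta (n + ev i + ev k)"] unfolding f by simp
  have kk: "- (1 / s n j k) = x * (- c n i k / s n k i - c n j k / s n j k) - y / s n k i"
    using xy[of "delta (n + ev k)"] nz unfolding f by (simp add: algebra_simps)
  have u: "- c n i j / s n i j - c n k j / s n j k
      = x * (- (c n i j * c n j i) / s n i j - c n j k * c n k j / s n j k - c n k i * c n i k / s n k i)
        + y * (- c n j i / s n i j - c n k i / s n k i)"
    using xy[of "delta n"] nz unfolding f by (simp add: algebra_simps)
  have i: "- (1 / s n i j) = x * (- c n j i / s n i j - c n k i / s n k i)
      + y * (c (n + ev i) j k * c (n + ev i) k j / s (n + ev i) j k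
         - c n j i / (s n i j * c n i j) - c n k i / (s n k i * c n i k))"
    using xy[of "delta (n + ev i)"] nz unfolding f by (simp add: algebra_simps)
  note r = mapping_from_row_relation[OF _ _ _ _ _ _ _ _ _ _ _ _ _ _ ijk jk ik kk u i]
  have "c n i j * c (n + ev i) k j = c n i k * c n k i - c n i k * c n k j - c n k i * c n i j"
    by (rule r(1)) (fact nz)+
  then show "c (n + ev i) k j = c_shift (c n) i k j"
    using nz by (simp add: c_shift_def field_simps)
  show "(c n i j * c n j i - c n i j * c n j k - c n j i * c n i k) * s (n + ev i) j k =
       c n i k * c (n + ev i) j k * (c n i k * (c n i j * s n j k - c n j i * s n k i
         + (c n k j - c n k i) * s n i j)
          - (c n i j * c n j i - c n i j * c n j k - c n j i * c n i k) * s n k i)"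
    by (rule r(2)) (fact nz)+
qed

lemma consistent_imp_governed:
  assumes "consistent c s"
  shows "governed_by_mapping c s"
proof -
  have c: "c (n + ev k) i j = c_shift (c n) k i j" if "distinct [i, j, k]" for n i j k
    using consistent_imp_shift_eqs(1)[OF assms, of k j i n] that by auto
  have s: "s (n + ev i) j k = s_shift (c n) (s n) i j k" if d: "distinct [i, j, k]" for n i j k
  proof -
    define r where "r = c n i j * c n j i - c n i j * c n j k - c n j i * c n i k"
    have "c n i k \<noteq> 0" "c (n + ev i) j k \<noteq> 0" using d c_nz by auto
    moreover have "c (n + ev i) j k = r / c n i k"
      using c[of j k i n] d unfolding r_def c_shift_def by (auto simp: mult.commute)
    \<comment> \<open>The formula for the shifted \<open>c\<close> shows that the factor in front of
      the shifted \<open>s\<close> is nonzero and may be cancelled.\<close>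
    ultimately have r: "r \<noteq> 0" "c n i k * c (n + ev i) j k = r" by auto
    have "r * s (n + ev i) j k = r * (c n i k * (c n i j * s n j k - c n j i * s n k i
         + (c n k j - c n k i) * s n i j) - r * s n k i)"
      using consistent_imp_shift_eqs(2)[OF assms d, of n] r(2) unfolding r_def[symmetric] by simp
    then have "s (n + ev i) j k = c n i k * (c n i j * s n j k - c n j i * s n k i
         + (c n k j - c n k i) * s n i j) - r * s n k i" using r(1) by simp
    then show ?thesis unfolding r_def s_shift_def by algebra
  qed
  show ?thesis unfolding governed_by_mapping_def using c s by auto
qed

section \<open>The mapping implies rank two\<close>

lemma governed_imp_spanned:
  fixes n :: "'d lattice" and i j k :: 'd
  assumes g: "governed_by_mapping c s" and d: "distinct [i, j, k]"
  defines "E \<equiv> corner_expr c s i j k n"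
  shows "\<exists>x y. y \<noteq> 0 \<and> (\<forall>u. E (n + ev j) u = x * E n u + y * E (n + ev i) u)" (is ?t1)
    and "spanned (E (n + ev j + ev k)) (E n) (E (n + ev i))"  (is ?t2)
    and "spanned (E (n + ev i + ev j + ev k)) (E n) (E (n + ev i))"  (is ?t3)
proof -
  have d': "distinct [j, k, i]" using d by auto
  have nz: "c m i j \<noteq> 0" "c m j i \<noteq> 0" "c m i k \<noteq> 0" "c m k i \<noteq> 0" "c m j k \<noteq> 0" "c m k j \<noteq> 0"
    "s m i j \<noteq> 0" "s m j k \<noteq> 0" "s m k i \<noteq> 0" for m
    using d c_nz s_nz by auto
  have gc: "c (n + ev k) i j = c_shift (c n) k i j" and gs: "s (n + ev k) i j = s_shift (c n) (s n) k i j"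
    if "distinct [i, j, k]" for n i j k using g that unfolding governed_by_mapping_def by auto
  interpret m: mapped_cube "c n i j" "c n j i" "c n j k" "c n k j" "c n k i" "c n i k"
    "s n j k" "s n k i" "s n i j" "s (n + ev i) j k" "s (n + ev j) k i" "s (n + ev k) i j"
    "c (n + ev i) j k" "c (n + ev i) k j" "c (n + ev j) i k" "c (n + ev j) k i"
    "c (n + ev k) i j" "c (n + ev k) j i"
  proof unfold_locales
    show "c n i k * c (n + ev i) j k = c n i j * c n j i - c n i j * c n j k - c n j i * c n i k"
      using gc[of j k i n] d nz by (auto simp: c_shift_def field_simps)
    show "c n j k * c (n + ev j) i k = c n i j * c n j i - c n i j * c n j k - c n j i * c n i k"
      using gc[of i k j n] d nz by (auto simp: c_shift_def field_simps)
    show "c n i j * c (n + ev i) k j = c n i k * c n k i - c n i k * c n k j - c n k i * c n i j"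
      using gc[of k j i n] d nz by (auto simp: c_shift_def field_simps)
    show "c n k j * c (n + ev k) i j = c n i k * c n k i - c n i k * c n k j - c n k i * c n i j"
      using gc[of i j k n] d nz by (auto simp: c_shift_def field_simps)
    show "c n j i * c (n + ev j) k i = c n j k * c n k j - c n j k * c n k i - c n k j * c n j i"
      using gc[of k i j n] d nz by (auto simp: c_shift_def field_simps)
    show "c n k i * c (n + ev k) j i = c n j k * c n k j - c n j k * c n k i - c n k j * c n j i"
      using gc[of j i k n] d nz by (auto simp: c_shift_def field_simps)
    show "s (n + ev i) j k = c n i j * c n i k * s n j k + c n i j * (c n j k - c n j i) * s n k i
        + c n i k * (c n k j - c n k i) * s n i j"
      using gs[of j k i n] d by (auto simp: s_shift_def)
    show "s (n + ev j) k i = c n j i * c n j k * s n k i + c n j k * (c n k i - c n k j) * s n i j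
        + c n j i * (c n i k - c n i j) * s n j k"
      using gs[of k i j n] d by (auto simp: s_shift_def)
    show "s (n + ev k) i j = c n k i * c n k j * s n i j + c n k i * (c n i j - c n i k) * s n j k
        + c n k j * (c n j i - c n j k) * s n k i"
      using gs[of i j k n] d by (auto simp: s_shift_def)
  qed (fact nz)+
  \<comment> \<open>With this choice the relation for the face shifted by \<open>ev i\<close> is
    immediate; the other two are the three-dimensional consistency.\<close>
  define G where "G u = face c j k (n + ev i) u + c (n + ev i) j k * face c k i n u
      + c (n + ev i) k j * face c i j n u" for u
  note e = vertex_swap[of n j i] vertex_swap[of n k i] vertex_swap[of n k j]
    vertex_rotate[of n j k i] vertex_swap[of "n + ev i" k j]
  have Q: "face c j k (n + ev i) u
        = G u - c (n + ev i) j k * face c k i n u - c (n + ev i) k j * face c i j n u"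
     "face c k i (n + ev j) u
        = G u - c (n + ev j) i k * face c j k n u - c (n + ev j) k i * face c i j n u"
     "face c i j (n + ev k) u
        = G u - c (n + ev k) i j * face c j k n u - c (n + ev k) j i * face c k i n u" for u
  proof -
    note r = m.opposite_face_relations[where u = "u n" and ui = "u (n + ev i)" and uj = "u (n + ev j)"
      and uk = "u (n + ev k)" and uij = "u (n + ev i + ev j)" and ujk = "u (n + ev j + ev k)"
      and uik = "u (n + ev i + ev k)" and uijk = "u (n + ev i + ev j + ev k)"]
    show "face c j k (n + ev i) u
        = G u - c (n + ev i) j k * face c k i n u - c (n + ev i) k j * face c i j n u"
      unfolding G_def by simp
    show "face c k i (n + ev j) u
        = G u - c (n + ev j) i k * face c j k n u - c (n + ev j) k i * face c i j n u"
      unfolding G_def face_def e by (rule r(1))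
    show "face c i j (n + ev k) u
        = G u - c (n + ev k) i j * face c j k n u - c (n + ev k) j i * face c k i n u"
      unfolding G_def face_def e by (rule r(2))
  qed
  have E: "E = corner_expr c s j k i n" unfolding E_def by (rule ext) (rule corner_expr_rotate[symmetric])
  have "E (n + ev j) u = - m.\<mu>k / s (n + ev j) k i * E n u
      + s (n + ev i) j k / s (n + ev j) k i * E (n + ev i) u" for u
    unfolding corner_exprs(2)[OF d', of n, folded E] unfolding E_def corner_exprs[OF d]
    by (rule m.row_j[OF Q(1,2)])
  \<comment> \<open>The nonzero multiplier allows the relation to be solved for row \<open>i\<close>
    as well.\<close>
  moreover have "s (n + ev i) j k / s (n + ev j) k i \<noteq> 0" using nz by simp
  ultimately show ?t1 by blast
  show ?t2 unfolding spanned_def E_def corner_exprs[OF d]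
    by (intro exI allI) (rule m.row_jk[OF Q])
  show ?t3 unfolding spanned_def E_def corner_exprs[OF d]
    by (intro exI allI) (rule m.row_ijk[OF Q])
qed

lemma governed_imp_consistent:
  assumes g: "governed_by_mapping c s"
  shows "consistent c s"
  unfolding consistent_def
proof (intro allI impI)
  fix n i j k assume d: "distinct [i, j, k :: 'd]"
  then have d': "distinct [j, k, i]" "distinct [k, i, j]" by auto
  define E where "E = corner_expr c s i j k n"
  have E: "corner_expr c s j k i n = E" "corner_expr c s k i j n = E"
    unfolding E_def by (intro ext corner_expr_rotate trans[OF corner_expr_rotate corner_expr_rotate])+
  note S = governed_imp_spanned[OF g d, of n, folded E_def]
  note S1 = governed_imp_spanned[OF g d'(1), of n, unfolded E]
  note S2 = governed_imp_spanned[OF g d'(2), of n, unfolded E]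
  have j: "spanned (E (n + ev j)) (E n) (E (n + ev i))"
    using S(1) unfolding spanned_def by blast
  \<comment> \<open>The rotated relation expresses row \<open>i\<close> by rows \<open>u\<close> and
    \<open>k\<close>; it is inverted to obtain row \<open>k\<close>.\<close>
  obtain x y where xy: "y \<noteq> 0" "\<And>u. E (n + ev i) u = x * E n u + y * E (n + ev k) u"
    using S2(1) by blast
  have "E (n + ev k) u = (- x / y) * E n u + (1 / y) * E (n + ev i) u" for u
    using xy by (simp add: field_simps)
  then have k: "spanned (E (n + ev k)) (E n) (E (n + ev i))"
    unfolding spanned_def by blast
  \<comment> \<open>Rotation yields this row from rows \<open>u\<close> and \<open>j\<close>, and
    row \<open>j\<close> is already spanned.\<close>
  have ik: "spanned (E (n + ev i + ev k)) (E n) (E (n + ev i))"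
    using spanned_trans[OF S1(2) j] by (simp add: ac_simps)
  have ij: "spanned (E (n + ev i + ev j)) (E n) (E (n + ev i))"
    using spanned_trans[OF S2(2) k] .
  have "spanned (E n) (E n) (E (n + ev i))" "spanned (E (n + ev i)) (E n) (E (n + ev i))"
    unfolding spanned_def by (rule exI[of _ 1], rule exI[of _ 0], simp)
      (rule exI[of _ 0], rule exI[of _ 1], simp)
  then show "corner_rank c s i j k n = 2"
    unfolding corner_rank_iff[OF d] cube_vertices_def E_def[symmetric]
    using j k ij ik S(2,3) by blast
qed

end

theorem theorem12:
  fixes c s :: "int ^ 'd::finite \<Rightarrow> 'd \<Rightarrow> 'd \<Rightarrow> real"
  assumes "CARD('d) \<ge> 3"
    and "\<And>n i j. i \<noteq> j \<Longrightarrow> c n i j \<noteq> 0"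
    and "\<And>n i j. i \<noteq> j \<Longrightarrow> s n i j \<noteq> 0"
    and "\<And>n i j. i \<noteq> j \<Longrightarrow> s n i j = - s n j i"
  shows "(consistent c s \<longleftrightarrow> governed_by_mapping c s) \<and> mapping_4D_consistent"
proof -
  interpret lattice_coeffs c s using assms by unfold_locales
  have "mapping_4D_consistent"
    unfolding mapping_4D_consistent_def
  proof (intro allI impI conjI)
    fix c s :: "4 coeffs" and i j k l :: 4
    assume "\<forall>i j. i \<noteq> j \<longrightarrow> c i j \<noteq> 0 \<and> s i j = - s j i"
      and "\<forall>i j k. distinct [i, j, k] \<longrightarrow> c_shift c k i j \<noteq> 0" and d: "distinct [i, j, k, l]"
    then have h: "\<And>i j. i \<noteq> j \<Longrightarrow> c i j \<noteq> 0" "\<And>i j. i \<noteq> j \<Longrightarrow> s i j = - s j i"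
      "\<And>i j k. distinct [i, j, k] \<Longrightarrow> c_shift c k i j \<noteq> 0" by blast+
    show "c_shift (c_shift c l) k i j = c_shift (c_shift c k) l i j"
      by (rule c_shift_commute[OF h(1,3) d])
    show "s_shift (c_shift c l) (s_shift c s l) k i j = s_shift (c_shift c k) (s_shift c s k) l i j"
      by (rule s_shift_commute[OF h(1,2) d])
  qed
  then show ?thesis
    using consistent_imp_governed governed_imp_consistent by blast
qed

end
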